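(* Let $p\ge 1$ be an integer. The map $\Phi_p$ is defined at every $p$-Łukasiewicz walk and restricts to a bijection $\mathcal L_p\to\mathcal T_p$ from $p$-Łukasiewicz walks to $p$-tandem walks. It preserves the total number of steps, maps $k$ to $\bar k$ (that is, $\bar k(\Phi_p(w))=k(w)$ for all $w\in\mathcal L_p$), and maps the number of $-1$ steps to the number of $(1,-1)$ steps (that is, for all $w\in\mathcal L_p$, the number of letters of $\Phi_p(w)$ equal to $(1,-1)$ equals the number of letters of $w$ equal to $-1$). The map $\Psi_p$ restricted to $\mathcal T_p$ is the inverse bijection $\mathcal T_p\to\mathcal L_p$.
   Context: Fix an integer $p\ge1$; $\mathbb N$ contains $0$; $A^*$ is the set of finite words on $A$, with empty word $\epsilon$. Alphabets: $\Sigma_p=\{-1,0,1,\dots,p\}$; $S_p=\{(-j,p-j):0\le j\le p\}\cup\{(1,-1)\}\subset\mathbb Z^2$; $A_p=\{a_{\ell,m}:\ell,m\in\mathbb N,\ 0\le\ell+m\le p-1\}$ (formal letters). $p$-Łukasiewicz walks: $\mathcal L_p$ is the set of words $w\in\Sigma_p^*$ such that the sum of the letters of $w$ is $0$ and the sum of the letters of every prefix of $w$ is $\ge0$. $p$-tandem walks: $\mathcal T_p$ is the set of words $\bar w\in S_p^*$ such that for every prefix the sum of its letters (in $\mathbb Z^2$) lies in $\mathbb N^2$ (a walk from the origin in the quarter plane). Transitions. A transition relates an input letter $\mu\in\Sigma_p$ and a left counter $(H_L,v_L)\in A_p^*\times\mathbb N$ to a right counter $(H_R,v_R)\in A_p^*\times\mathbb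 N$ and an output letter $\bar a\in S_p$. Written as $\mu;\ (H_L,v_L)\to(H_R,v_R);\ \bar a$, with arbitrary $\Lambda\in A_p^*$, $\beta\in\mathbb N$, $a_{\ell,m}\in A_p$, they are: (T1) $p;\ (\Lambda,\beta)\to(\Lambda,\beta+p);\ (0,p)$. (T2) $q;\ (\Lambda,0)\to(\Lambda,q);\ (0,p)$, for $0\le q\le p-1$. (T3) $-1;\ (\Lambda a_{\ell,m},0)\to(\Lambda,\ell);\ (-m-1,p-m-1)$, for $\ell+m\le p-1$. (T4) $-1;\ (\Lambda a_{\ell,m},\beta+1)\to(\Lambda,\beta+\ell+1);\ (-m-1,p-m-1)$, for $\ell+m=p-1$. (T5) $q;\ (\Lambda,\beta+1)\to(\Lambda a_{q,0},\beta);\ (1,-1)$, for $0\le q\le p-1$. (T6) $-1;\ (\Lambda a_{\ell,m},\beta+1)\to(\Lambda a_{\ell,m+1},\beta);\ (1,-1)$, for $\ell+m\le p-2$. (T7) $-1;\ (\epsilon,\beta+1)\to(\epsilon,\beta);\ (1,-1)$. (T8) $-1;\ (\epsilon,0)\to$ error. Each triple $(\mu,H_L,v_L)\in\Sigma_p\times A_p^*\times\mathbb N$ matches the left side of exactly one of (T1)–(T8), and each triple $(H_R,v_R,\bar a)\in A_p^*\times\mathbb N\times S_p$ matches the right side of exactly one of (T1)–(T7) and determines $(\mu,H_L,v_L)$. Forward (LR) process and $\Phi_p$: given $w=w_1\cdots w_n\in\Sigma_p^*$, start with $(H_0,v_0)=(\epsilon,0)$; for $i=1,\dots,n$ apply the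 unique transition matching $(w_i,H_{i-1},v_{i-1})$ to get $(H_i,v_i)$ and $\bar w_i$. If (T8) is ever used, $\Phi_p(w)$ is undefined; otherwise $\Phi_p(w)=\bar w_1\cdots\bar w_n\in S_p^*$. Backward (RL) process and $\Psi_p$: given $\bar w=\bar w_1\cdots\bar w_n\in S_p^*$, start with $(H_n,v_n)=(\epsilon,0)$; for $i=n,n-1,\dots,1$ apply in reverse the unique transition among (T1)–(T7) matching $(H_i,v_i,\bar w_i)$ to get $w_i$ and $(H_{i-1},v_{i-1})$. Then $\Psi_p(\bar w)=w_1\cdots w_n\in\Sigma_p^*$. Statistics: for $w\in\Sigma_p^*$, $k(w)$ is the sum over the letters $\mu$ of $w$ of the quantity equal to $p$ if $0\le\mu\le p$ and to $-2$ if $\mu=-1$. For $\bar w\in S_p^*$, $\bar k(\bar w)$ is the sum over the letters $(\bar a_1,\bar a_2)$ of $\bar w$ of $\bar a_2-\bar a_1$. *)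

theory Defs
  imports "HOL-Library.Sublist" "HOL-Library.Product_Plus"
begin

definition Sigma_letters :: "nat \<Rightarrow> int set" where
  "Sigma_letters p = {-1..int p}"

definition S_letters :: "nat \<Rightarrow> (int \<times> int) set" where
  "S_letters p = {(- int j, int p - int j) | j. j \<le> p} \<union> {(1, -1)}"

text \<open>The formal letter \<open>a\<^sub>\<ell>\<^sub>,\<^sub>m\<close> is encoded as the pair \<open>(\<ell>, m)\<close>. Bounds such as
  \<open>\<ell> + m \<le> p - 1\<close> and \<open>\<ell> + m \<le> p - 2\<close> are written without subtraction, since subtraction
  on \<^typ>\<open>nat\<close> truncates.\<close>

type_synonym letter = "nat \<times> nat"

type_synonym counter = "letter list \<times> nat"

definition A_letters :: "nat \<Rightarrow> letter set" where
  "A_letters p = {(l, m). l + m < p}"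

definition lukasiewicz_walks :: "nat \<Rightarrow> int list set" where
  "lukasiewicz_walks p =
     {w \<in> lists (Sigma_letters p). sum_list w = 0 \<and> (\<forall>u. prefix u w \<longrightarrow> sum_list u \<ge> 0)}"

definition tandem_walks :: "nat \<Rightarrow> (int \<times> int) list set" where
  "tandem_walks p =
     {x \<in> lists (S_letters p).
        \<forall>u. prefix u x \<longrightarrow> fst (sum_list u) \<ge> 0 \<and> snd (sum_list u) \<ge> 0}"

text \<open>\<open>transition p \<mu> (H\<^sub>L, v\<^sub>L) (H\<^sub>R, v\<^sub>R) a\<close> stands for
  \<open>\<mu>; (H\<^sub>L, v\<^sub>L) \<rightarrow> (H\<^sub>R, v\<^sub>R); a\<close>. The error transition, for input \<open>-1\<close> at the
  counter \<open>(\<epsilon>, 0)\<close>, is not part of this relation; it is handled by \<open>Phi_from\<close>.\<close>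

inductive transition ::
  "nat \<Rightarrow> int \<Rightarrow> counter \<Rightarrow> counter \<Rightarrow> int \<times> int \<Rightarrow> bool" for p :: nat where
  T1: "\<Lambda> \<in> lists (A_letters p) \<Longrightarrow>
    transition p (int p) (\<Lambda>, \<beta>) (\<Lambda>, \<beta> + p) (0, int p)"
| T2: "\<Lambda> \<in> lists (A_letters p) \<Longrightarrow> q < p \<Longrightarrow>
    transition p (int q) (\<Lambda>, 0) (\<Lambda>, q) (0, int p)"
| T3: "\<Lambda> \<in> lists (A_letters p) \<Longrightarrow> l + m < p \<Longrightarrow>
    transition p (-1) (\<Lambda> @ [(l, m)], 0) (\<Lambda>, l) (- int m - 1, int p - int m - 1)"
| T4: "\<Lambda> \<in> lists (A_letters p) \<Longrightarrow> l + m + 1 = p \<Longrightarrow>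
    transition p (-1) (\<Lambda> @ [(l, m)], \<beta> + 1) (\<Lambda>, \<beta> + l + 1)
      (- int m - 1, int p - int m - 1)"
| T5: "\<Lambda> \<in> lists (A_letters p) \<Longrightarrow> q < p \<Longrightarrow>
    transition p (int q) (\<Lambda>, \<beta> + 1) (\<Lambda> @ [(q, 0)], \<beta>) (1, -1)"
| T6: "\<Lambda> \<in> lists (A_letters p) \<Longrightarrow> l + m + 1 < p \<Longrightarrow>
    transition p (-1) (\<Lambda> @ [(l, m)], \<beta> + 1) (\<Lambda> @ [(l, m + 1)], \<beta>) (1, -1)"
| T7: "transition p (-1) ([], \<beta> + 1) ([], \<beta>) (1, -1)"

text \<open>The next two lemmas justify the definite descriptions used below.\<close>

lemma transition_forward_ex1:
  assumes "\<mu> \<in> Sigma_letters p" "H \<in> lists (A_letters p)" "\<not> (\<mu> = -1 \<and> H = [] \<and> v = 0)"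
  shows "\<exists>!(c', a). transition p \<mu> (H, v) c' a"
proof -
  have mu: "\<mu> = -1 \<or> \<mu> = int p \<or> (\<exists>q<p. \<mu> = int q)"
  proof (cases "\<mu> < 0")
    case True
    with assms(1) show ?thesis by (auto simp: Sigma_letters_def)
  next
    case False
    then obtain q where "\<mu> = int q" by (metis not_less nonneg_int_cases)
    with assms(1) show ?thesis by (auto simp: Sigma_letters_def)
  qed
  show ?thesis
  proof (cases H rule: rev_cases)
    case Nil
    with mu assms show ?thesis
      by (cases v) (auto simp: transition.simps)
  next
    case (snoc \<Lambda> lm)
    obtain l m where lm: "lm = (l, m)" by (cases lm)
    from snoc lm assms(2) have "\<Lambda> \<in> lists (A_letters p)" "l + m < p"
      by (auto simp: A_letters_def)
    moreover have "l + m + 1 = p \<or> l + m + 1 < p" using \<open>l + m < p\<close> by auto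
    ultimately show ?thesis using mu snoc lm assms(2)
      by (cases v) (auto simp: transition.simps)
  qed
qed

lemma transition_forward_closed:
  assumes "transition p \<mu> c (H', v') a"
  shows "H' \<in> lists (A_letters p)" "a \<in> S_letters p"
  using assms by (auto elim!: transition.cases simp: A_letters_def S_letters_def
      intro: exI[of _ "0::nat"] exI[of _ "Suc m" for m])

lemma transition_backward_ex1:
  assumes "p \<ge> 1" "a \<in> S_letters p" "H' \<in> lists (A_letters p)"
  shows "\<exists>!(\<mu>, c). transition p \<mu> c (H', v') a"
proof -
  consider (z) "a = (0, int p)" | (s) m where "m < p" "a = (- int m - 1, int p - int m - 1)"
    | (d) "a = (1, -1)"
  proof -
    have "\<exists>m<p. a = (- int m - 1, int p - int m - 1)" if "a = (- int j, int p - int j)" "j \<noteq> 0" "j \<le> p" for j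
      using that by (intro exI[of _ "j - 1"]) auto
    then show thesis using assms(2) that by (fastforce simp: S_letters_def)
  qed
  then show ?thesis
  proof cases
    case z
    show ?thesis
    proof (cases "v' < p")
      case True
      then show ?thesis using z assms by (auto simp: transition.simps)
    next
      case False
      then obtain b where "v' = b + p" by (metis not_less le_add_diff_inverse2)
      then show ?thesis using z assms by (auto simp: transition.simps)
    qed
  next
    case (s m)
    show ?thesis
    proof (cases "v' + m < p")
      case True
      then show ?thesis using s assms by (auto simp: transition.simps)
    next
      case False
      define b where "b = v' + m - p"
      define l where "l = p - m - 1"
      have "v' = b + l + 1" "l + m + 1 = p" using False s(1) by (auto simp: b_def l_def)
      then show ?thesis using s assms by (auto simp: transition.simps)
    qed
  next
    case d
    show ?thesis
    proof (cases H' rule: rev_cases)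
      case Nil
      then show ?thesis using d assms by (auto simp: transition.simps)
    next
      case (snoc \<Lambda> lm)
      obtain l m where lm: "lm = (l, m)" by (cases lm)
      from snoc lm assms(3) have "\<Lambda> \<in> lists (A_letters p)" "l + m < p"
        by (auto simp: A_letters_def)
      then show ?thesis using d snoc lm assms
        by (cases m) (auto simp: transition.simps)
    qed
  qed
qed

lemma transition_backward_closed:
  assumes "transition p \<mu> (H, v) c' a"
  shows "H \<in> lists (A_letters p)" "\<mu> \<in> Sigma_letters p"
  using assms by (auto elim!: transition.cases simp: A_letters_def Sigma_letters_def)

fun Phi_from :: "nat \<Rightarrow> counter \<Rightarrow> int list \<Rightarrow> (int \<times> int) list option" where
  "Phi_from p c [] = Some []"
| "Phi_from p c (\<mu> # w) =
     (if \<mu> = -1 \<and> c = ([], 0) then None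
      else let (c', a) = (THE (c', a). transition p \<mu> c c' a)
           in map_option (\<lambda>x. a # x) (Phi_from p c' w))"

text \<open>\<^term>\<open>None\<close> means that the forward process ran into the error transition.\<close>

definition Phi :: "nat \<Rightarrow> int list \<Rightarrow> (int \<times> int) list option" where
  "Phi p w = Phi_from p ([], 0) w"

text \<open>The backward process reads its input from right to left: \<open>Psi_from p c x\<close> starts from the
  counter \<open>c\<close> at the right end of \<open>x\<close> and returns the counter reached at the left end together
  with the word produced.\<close>

fun Psi_from :: "nat \<Rightarrow> counter \<Rightarrow> (int \<times> int) list \<Rightarrow> counter \<times> int list" where
  "Psi_from p c [] = (c, [])"
| "Psi_from p c (a # x) =
     (let (c', w) = Psi_from p c x;
          (\<mu>, c'') = (THE (\<mu>, c''). transition p \<mu> c'' c' a)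
      in (c'', \<mu> # w))"

definition Psi :: "nat \<Rightarrow> (int \<times> int) list \<Rightarrow> int list" where
  "Psi p x = snd (Psi_from p ([], 0) x)"

definition k_stat :: "nat \<Rightarrow> int list \<Rightarrow> int" where
  "k_stat p w = (\<Sum>\<mu>\<leftarrow>w. if \<mu> = -1 then -2 else int p)"

definition kbar_stat :: "(int \<times> int) list \<Rightarrow> int" where
  "kbar_stat x = (\<Sum>(a\<^sub>1, a\<^sub>2)\<leftarrow>x. a\<^sub>2 - a\<^sub>1)"

end

theory Submission
  imports Defs
begin

text \<open>Read from left to right, the height of the walk \<open>w\<close> is \<open>v + \<Sum> (\<ell> + 1)\<close>, summed over the
  letters \<open>a\<^sub>\<ell>\<^sub>,\<^sub>m\<close> of \<open>H\<close>. Hence the forward process from \<open>(\<epsilon>, 0)\<close> meets the error exactly when the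
  walk becomes negative, and it ends in \<open>(\<epsilon>, 0)\<close> exactly when the walk ends at height \<open>0\<close>.
  On the output side, \<open>x - \<Sum> (m + 1)\<close> and \<open>y - v\<close> never decrease, so the output stays in the
  quarter plane. The first quantity increases only while \<open>H = \<epsilon>\<close> (by T7) and the second only while
  \<open>v = 0\<close> (by T2 and T3), so a run from \<open>(H, v)\<close> to \<open>(\<epsilon>, 0)\<close> visits points with
  \<open>x = - \<Sum> (m + 1)\<close> and with \<open>y = - v\<close>; a tandem walk therefore forces \<open>(H, v) = (\<epsilon>, 0)\<close>.
  Finally, the length of \<open>H\<close> counts the excess of output letters \<open>(1, -1)\<close> over input letters
  \<open>-1\<close>.\<close>

text \<open>A relation that favours no reading direction: the forward and the backward process both
  compute it, so one induction over a run serves both.\<close>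

inductive run :: "nat \<Rightarrow> counter \<Rightarrow> int list \<Rightarrow> (int \<times> int) list \<Rightarrow> counter \<Rightarrow> bool"
  for p :: nat where
  run_Nil: "run p c [] [] c"
| run_Cons: "transition p \<mu> c c' a \<Longrightarrow> run p c' w x c'' \<Longrightarrow> run p c (\<mu> # w) (a # x) c''"

section \<open>Weights of a counter and their change in one transition\<close>

definition height :: "counter \<Rightarrow> int" where
  "height c = int (snd c) + (\<Sum>(l, m)\<leftarrow>fst c. int l + 1)"

text \<open>A letter \<open>(l, m)\<close> stands for \<open>m + 1\<close> output steps
  \<open>(1, -1)\<close>: T5 and T6 emit them, and the pop in T3 or T4 takes \<open>m + 1\<close>
  back from the x-coordinate.\<close>

definition x_weight :: "counter \<Rightarrow> int" where
  "x_weight c = (\<Sum>(l, m)\<leftarrow>fst c. int m + 1)"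

lemma sum_list_ge_length:
  fixes f :: "'a \<Rightarrow> nat"
  shows "(\<Sum>z\<leftarrow>zs. int (f z) + 1) \<ge> int (length zs)"
  by (induction zs) auto

lemma height_ge: "height c \<ge> int (snd c) + int (length (fst c))"
  using sum_list_ge_length[where f = fst and zs = "fst c"] by (simp add: height_def case_prod_unfold)

lemma x_weight_ge: "x_weight c \<ge> int (length (fst c))"
  using sum_list_ge_length[where f = snd and zs = "fst c"] by (simp add: x_weight_def case_prod_unfold)

lemma height_nonneg: "height c \<ge> 0"
  using height_ge[of c] by linarith

lemma x_weight_nonneg: "x_weight c \<ge> 0"
  using x_weight_ge[of c] by linarith

lemma height_eq_0_iff: "height c = 0 \<longleftrightarrow> c = ([], 0)"
proof
  assume "height c = 0"
  then have "int (snd c) + int (length (fst c)) \<le> 0" using height_ge[of c] by simp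
  then have "snd c = 0" "length (fst c) = 0" by linarith+
  then show "c = ([], 0)" by (simp add: prod_eq_iff)
qed (simp add: height_def)

lemma transition_height: "transition p \<mu> c c' a \<Longrightarrow> height c' = height c + \<mu>"
  by (induction rule: transition.induct) (auto simp: height_def)

lemma transition_x_weight: "transition p \<mu> c c' a \<Longrightarrow> x_weight c' \<le> x_weight c + fst a"
  by (induction rule: transition.induct) (auto simp: x_weight_def)

lemma transition_x_weight_eq:
  "transition p \<mu> c c' a \<Longrightarrow> fst c \<noteq> [] \<Longrightarrow> x_weight c' = x_weight c + fst a"
  by (induction rule: transition.induct) (auto simp: x_weight_def)

lemma transition_snd: "transition p \<mu> c c' a \<Longrightarrow> int (snd c') \<le> int (snd c) + snd a"
  by (induction rule: transition.induct) auto

lemma transition_snd_eq: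
  "transition p \<mu> c c' a \<Longrightarrow> snd c \<noteq> 0 \<Longrightarrow> int (snd c') = int (snd c) + snd a"
  by (induction rule: transition.induct) auto

lemma transition_count:
  "transition p \<mu> c c' a \<Longrightarrow>
    int (length (fst c')) = int (length (fst c)) + of_bool (a = (1, -1)) - of_bool (\<mu> = -1)"
  by (induction rule: transition.induct) auto

text \<open>Both statistics only take the values \<open>p\<close> and \<open>-2\<close> on letters,
  so an input and an output of different kinds differ by \<open>p + 2\<close>, and exactly then the
  length of the stack changes by one.\<close>

lemma transition_stat:
  "transition p \<mu> c c' a \<Longrightarrow>
    snd a - fst a + (int p + 2) * int (length (fst c')) =
      (if \<mu> = -1 then -2 else int p) + (int p + 2) * int (length (fst c))"
  by (induction rule: transition.induct) (auto simp: algebra_simps)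

section \<open>Determinism, and runs as graphs of the two processes\<close>

lemma transition_right_unique:
  assumes "transition p \<mu> c c1 a1" "transition p \<mu> c c2 a2"
  shows "(c1, a1) = (c2, a2)"
proof -
  obtain H v where c: "c = (H, v)" by (cases c)
  have "\<mu> \<in> Sigma_letters p" "H \<in> lists (A_letters p)"
    using assms(1) transition_backward_closed unfolding c by blast+
  \<comment> \<open>In the error case the right counter would have height -1.\<close>
  moreover have "\<not> (\<mu> = -1 \<and> H = [] \<and> v = 0)"
    using transition_height[OF assms(1)] height_nonneg[of c1] by (auto simp: c height_def)
  ultimately have "\<exists>!(c', a). transition p \<mu> (H, v) c' a"
    by (rule transition_forward_ex1)
  then show ?thesis using assms unfolding c by auto
qed

lemma transition_left_unique:
  assumes "p \<ge> 1" "transition p \<mu>1 c1 c' a" "transition p \<mu>2 c2 c' a"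
  shows "(\<mu>1, c1) = (\<mu>2, c2)"
proof -
  obtain H' v' where c': "c' = (H', v')" by (cases c')
  have "a \<in> S_letters p" "H' \<in> lists (A_letters p)"
    using assms(2) transition_forward_closed unfolding c' by blast+
  with assms(1) have "\<exists>!(\<mu>, c). transition p \<mu> c (H', v') a"
    by (rule transition_backward_ex1)
  then show ?thesis using assms(2,3) unfolding c' by auto
qed

lemma run_Phi_from: "run p c w x c' \<Longrightarrow> Phi_from p c w = Some x"
proof (induction rule: run.induct)
  case (run_Cons \<mu> c c' a w x c'')
  have "(THE (c', a). transition p \<mu> c c' a) = (c', a)"
    using run_Cons.hyps(1)
    by (intro the_equality) (auto dest: transition_right_unique[OF run_Cons.hyps(1)])
  moreover have "\<not> (\<mu> = -1 \<and> c = ([], 0))"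
    using transition_height[OF run_Cons.hyps(1)] height_nonneg[of c'] by (auto simp: height_def)
  ultimately show ?case using run_Cons.IH by auto
qed simp

lemma run_Psi_from: "run p c w x c' \<Longrightarrow> p \<ge> 1 \<Longrightarrow> Psi_from p c' x = (c, w)"
proof (induction rule: run.induct)
  case (run_Cons \<mu> c c' a w x c'')
  have "(THE (\<mu>, c). transition p \<mu> c c' a) = (\<mu>, c)"
    using run_Cons.hyps(1)
    by (intro the_equality)
      (auto dest: transition_left_unique[OF run_Cons.prems run_Cons.hyps(1)])
  then show ?case using run_Cons.IH run_Cons.prems by auto
qed simp

lemma run_letters: "run p c w x c' \<Longrightarrow> w \<in> lists (Sigma_letters p) \<and> x \<in> lists (S_letters p)"
proof (induction rule: run.induct)
  case (run_Cons \<mu> c c' a w x c'')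
  then show ?case
    by (metis lists.Cons prod.collapse transition_backward_closed(2) transition_forward_closed(2))
qed simp

section \<open>Existence of runs\<close>

lemma run_forward_exists:
  assumes "w \<in> lists (Sigma_letters p)" "fst c \<in> lists (A_letters p)"
    and "\<And>u. prefix u w \<Longrightarrow> height c + sum_list u \<ge> 0"
  shows "\<exists>x c'. run p c w x c'"
  using assms
proof (induction w arbitrary: c rule: list.induct)
  case Nil
  show ?case using run_Nil by blast
next
  case (Cons \<mu> w)
  obtain H v where c: "c = (H, v)" by (cases c)
  \<comment> \<open>The one-letter prefix already excludes the error at this step.\<close>
  have "height c + \<mu> \<ge> 0" using Cons.prems(3)[of "[\<mu>]"] by simp
  then have "\<not> (\<mu> = -1 \<and> H = [] \<and> v = 0)" by (auto simp: c height_def)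
  then have "\<exists>!(c', a). transition p \<mu> (H, v) c' a"
    using Cons.prems(1,2) by (intro transition_forward_ex1) (auto simp: c)
  then obtain c' a where t: "transition p \<mu> c c' a" unfolding c by auto
  have "\<exists>x c''. run p c' w x c''"
  proof (rule Cons.IH)
    show "fst c' \<in> lists (A_letters p)"
      using t transition_forward_closed(1) by (metis prod.collapse)
    show "height c' + sum_list u \<ge> 0" if "prefix u w" for u
      using Cons.prems(3)[of "\<mu> # u"] that transition_height[OF t] by simp
  qed (use Cons.prems in auto)
  then show ?case using t run_Cons by blast
qed

text \<open>The reversed process has no error case, so the left counter is found, not prescribed.
  Its stack must stay over \<open>A_letters p\<close> for the next reversed transition to
  exist.\<close>

lemma run_backward_exists:
  assumes "p \<ge> 1" "x \<in> lists (S_letters p)" "fst c' \<in> lists (A_letters p)"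
  shows "\<exists>c w. fst c \<in> lists (A_letters p) \<and> run p c w x c'"
  using assms(2)
proof (induction x)
  case Nil
  show ?case using run_Nil assms(3) by blast
next
  case (Cons a x)
  then obtain H v w where c: "H \<in> lists (A_letters p)" "run p (H, v) w x c'"
    by fastforce
  have "\<exists>!(\<mu>, c). transition p \<mu> c (H, v) a"
    using Cons.hyps c(1) assms(1) by (intro transition_backward_ex1)
  then obtain \<mu> c where "transition p \<mu> c (H, v) a" by auto
  then show ?case
    using c(2) run_Cons transition_backward_closed(1) by (metis prod.collapse)
qed

section \<open>Quantities followed along runs\<close>

lemma run_height: "run p c w x c' \<Longrightarrow> height c' = height c + sum_list w"
  by (induction rule: run.induct) (auto dest: transition_height)

lemma run_height_prefix: "run p c w x c' \<Longrightarrow> prefix u w \<Longrightarrow> height c + sum_list u \<ge> 0"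
proof (induction arbitrary: u rule: run.induct)
  case (run_Cons \<mu> c c' a w x c'')
  then show ?case
    using transition_height[OF run_Cons.hyps(1)] by (fastforce simp: prefix_Cons height_nonneg)
qed (simp add: height_nonneg)

text \<open>The left side bounds from above the \<open>x_weight\<close> of the counter reached after
  \<open>u\<close>, which is nonnegative.\<close>

lemma run_x_prefix: "run p c w x c' \<Longrightarrow> prefix u x \<Longrightarrow> x_weight c + fst (sum_list u) \<ge> 0"
proof (induction arbitrary: u rule: run.induct)
  case (run_Cons \<mu> c c' a w x c'')
  then show ?case
    using transition_x_weight[OF run_Cons.hyps(1)]
    by (fastforce simp: prefix_Cons x_weight_nonneg)
qed (simp add: x_weight_nonneg)

lemma run_y_prefix: "run p c w x c' \<Longrightarrow> prefix u x \<Longrightarrow> int (snd c) + snd (sum_list u) \<ge> 0"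
proof (induction arbitrary: u rule: run.induct)
  case (run_Cons \<mu> c c' a w x c'')
  then show ?case
    using transition_snd[OF run_Cons.hyps(1)] by (fastforce simp: prefix_Cons)
qed simp

text \<open>Take \<open>u\<close> up to the first moment when the stack is empty. Until then
  \<open>x_weight\<close> follows the x-coordinate exactly, and there it is 0.\<close>

lemma run_reaches_x:
  "run p c w x c' \<Longrightarrow> fst c' = [] \<Longrightarrow> \<exists>u. prefix u x \<and> fst (sum_list u) = - x_weight c"
proof (induction rule: run.induct)
  case (run_Nil c)
  then show ?case by (simp add: x_weight_def)
next
  case (run_Cons \<mu> c c' a w x c'')
  show ?case
  proof (cases "fst c = []")
    case True
    then show ?thesis by (intro exI[of _ "[]"]) (simp add: x_weight_def)
  next
    case False
    from run_Cons obtain u where "prefix u x" "fst (sum_list u) = - x_weight c'" by blast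
    then show ?thesis
      using transition_x_weight_eq[OF run_Cons.hyps(1) False]
      by (intro exI[of _ "a # u"]) simp
  qed
qed

text \<open>Here \<open>u\<close> ends when the number in the counter is first 0; before that it
  follows the y-coordinate exactly.\<close>

lemma run_reaches_y:
  "run p c w x c' \<Longrightarrow> snd c' = 0 \<Longrightarrow> \<exists>u. prefix u x \<and> snd (sum_list u) = - int (snd c)"
proof (induction rule: run.induct)
  case (run_Nil c)
  then show ?case by simp
next
  case (run_Cons \<mu> c c' a w x c'')
  show ?case
  proof (cases "snd c = 0")
    case True
    then show ?thesis by (intro exI[of _ "[]"]) simp
  next
    case False
    from run_Cons obtain u where "prefix u x" "snd (sum_list u) = - int (snd c')" by blast
    then show ?thesis
      using transition_snd_eq[OF run_Cons.hyps(1) False]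
      by (intro exI[of _ "a # u"]) simp
  qed
qed

lemma run_length: "run p c w x c' \<Longrightarrow> length x = length w"
  by (induction rule: run.induct) auto

lemma run_count:
  "run p c w x c' \<Longrightarrow>
    int (length (fst c')) + int (count_list w (-1)) =
      int (length (fst c)) + int (count_list x (1, -1))"
proof (induction rule: run.induct)
  case (run_Cons \<mu> c c' a w x c'')
  then show ?case using transition_count[OF run_Cons.hyps(1)]
    by (cases "a = (1, -1)"; cases "\<mu> = -1") simp_all
qed simp

lemma run_stat:
  "run p c w x c' \<Longrightarrow>
    kbar_stat x + (int p + 2) * int (length (fst c')) =
      k_stat p w + (int p + 2) * int (length (fst c))"
proof (induction rule: run.induct)
  case (run_Cons \<mu> c c' a w x c'')
  then show ?case
    using transition_stat[OF run_Cons.hyps(1)]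
    by (simp add: kbar_stat_def k_stat_def case_prod_unfold)
qed (simp add: kbar_stat_def k_stat_def)

section \<open>Both classes of walks as runs from \<open>([], 0)\<close> to itself\<close>

lemma lukasiewicz_iff_run:
  "w \<in> lukasiewicz_walks p \<longleftrightarrow> (\<exists>x. run p ([], 0) w x ([], 0))"
proof
  assume w: "w \<in> lukasiewicz_walks p"
  then obtain x c where r: "run p ([], 0) w x c"
    using run_forward_exists[of w p "([], 0)"] by (auto simp: lukasiewicz_walks_def height_def)
  moreover have "c = ([], 0)"
    using run_height[OF r] w by (simp add: lukasiewicz_walks_def height_def[of "([], 0)"]
      flip: height_eq_0_iff)
  ultimately show "\<exists>x. run p ([], 0) w x ([], 0)" by blast
next
  assume "\<exists>x. run p ([], 0) w x ([], 0)"
  then obtain x where r: "run p ([], 0) w x ([], 0)" ..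
  show "w \<in> lukasiewicz_walks p"
    using run_letters[OF r] run_height[OF r] run_height_prefix[OF r]
    by (auto simp: lukasiewicz_walks_def height_def)
qed

lemma tandem_iff_run:
  assumes "p \<ge> 1"
  shows "x \<in> tandem_walks p \<longleftrightarrow> (\<exists>w. run p ([], 0) w x ([], 0))"
proof
  assume x: "x \<in> tandem_walks p"
  then obtain c w where r: "run p c w x ([], 0)"
    using run_backward_exists[OF assms, of x "([], 0)"] by (auto simp: tandem_walks_def)
  \<comment> \<open>Some prefix ends at x-coordinate \<open>- x_weight c\<close>, which the quarter
    plane forces to be nonnegative.\<close>
  have "x_weight c \<le> 0"
    using run_reaches_x[OF r] x by (fastforce simp: tandem_walks_def)
  then have "length (fst c) = 0" using x_weight_ge[of c] by linarith
  moreover have "snd c = 0"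
    using run_reaches_y[OF r] x by (fastforce simp: tandem_walks_def)
  ultimately show "\<exists>w. run p ([], 0) w x ([], 0)" using r by (cases c) auto
next
  assume "\<exists>w. run p ([], 0) w x ([], 0)"
  then obtain w where r: "run p ([], 0) w x ([], 0)" ..
  show "x \<in> tandem_walks p"
    using run_letters[OF r] run_x_prefix[OF r] run_y_prefix[OF r]
    by (auto simp: tandem_walks_def x_weight_def)
qed

theorem theorem6:
  fixes p :: nat
  assumes "p \<ge> 1"
  shows "(\<forall>w \<in> lukasiewicz_walks p. Phi p w \<noteq> None)
    \<and> bij_betw (\<lambda>w. the (Phi p w)) (lukasiewicz_walks p) (tandem_walks p)
    \<and> (\<forall>w \<in> lukasiewicz_walks p.
          length (the (Phi p w)) = length w
        \<and> kbar_stat (the (Phi p w)) = k_stat p w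
        \<and> count_list (the (Phi p w)) (1, -1) = count_list w (-1))
    \<and> bij_betw (Psi p) (tandem_walks p) (lukasiewicz_walks p)
    \<and> (\<forall>w \<in> lukasiewicz_walks p. Psi p (the (Phi p w)) = w)
    \<and> (\<forall>x \<in> tandem_walks p. Phi p (Psi p x) = Some x)"
proof -
  have luk: "\<exists>x. Phi p w = Some x \<and> x \<in> tandem_walks p \<and> Psi p x = w
      \<and> length x = length w \<and> kbar_stat x = k_stat p w
      \<and> count_list x (1, -1) = count_list w (-1)" if w: "w \<in> lukasiewicz_walks p" for w
  proof -
    obtain x where r: "run p ([], 0) w x ([], 0)" using w lukasiewicz_iff_run by blast
    \<comment> \<open>The stack is empty at both ends, so the length terms in
      \<open>run_stat\<close> and \<open>run_count\<close> vanish.\<close>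
    show ?thesis
      using run_Phi_from[OF r] run_Psi_from[OF r assms] tandem_iff_run[OF assms] r
        run_length[OF r] run_stat[OF r] run_count[OF r]
      by (auto simp: Phi_def Psi_def)
  qed
  have tan: "Phi p (Psi p x) = Some x \<and> Psi p x \<in> lukasiewicz_walks p"
    if x: "x \<in> tandem_walks p" for x
  proof -
    obtain w where r: "run p ([], 0) w x ([], 0)" using x tandem_iff_run[OF assms] by blast
    show ?thesis
      using run_Phi_from[OF r] run_Psi_from[OF r assms] lukasiewicz_iff_run r
      by (auto simp: Phi_def Psi_def)
  qed
  have "bij_betw (\<lambda>w. the (Phi p w)) (lukasiewicz_walks p) (tandem_walks p)"
    by (rule bij_betw_byWitness[where f' = "Psi p"]) (use luk tan in force)+
  moreover have "bij_betw (Psi p) (tandem_walks p) (lukasiewicz_walks p)"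
    by (rule bij_betw_byWitness[where f' = "\<lambda>w. the (Phi p w)"]) (use luk tan in force)+
  ultimately show ?thesis using luk tan by fastforce
qed

end
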